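(* Let $N_f$ be an even positive integer and put $\tilde N_f = N_f+1$. Consider a sequence of networks $G_1, G_2, \dots$ with node counts $N_k = N_{k-1}+1$ for $k \ge 2$, where $N_f < N_k - 2$ for all $k$. Together with the networks, maintain an auxiliary cycle $C_k$ whose node set is the node set of $G_k$ ($C_k$ is bookkeeping only). Let $G_1$ be the network on the nodes of $C_1$ in which every node is linked to every node within distance $N_f/2$ along $C_1$, and in addition: if $N_1$ is even, every pair of nodes at distance $N_1/2$ along $C_1$ is linked; if $N_1$ is odd, every node is linked to at least one node at distance $(N_1-1)/2$ along $C_1$, in such a way that exactly one node is adjacent to $\tilde N_f+1$ nodes. For $k \ge 2$, obtain $G_k$ from $G_{k-1}$ as follows: (i) form $C_k$ from $C_{k-1}$ by inserting the new node between two adjacent nodes of $C_{k-1}$; (ii) link the new node to all nodes within distance $N_f/2$ of it along $C_k$; (iii) if $N_k$ is even, link the new node to the node at distance $N_k/2$ along $C_k$; if $N_k$ is odd, link the new node to a node at distance $(N_k-1)/2$ along $C_k$; (iv) if $N_k$ is even, link every pair of nodes at distance $N_k/2$ along $C_k$ that is not already linked; no links are removed. Then $G_i$ is a subnetwork of $G_j$ for all $i \le j$, every $G_k$ is $N_f$-robust, and the number of links $L_k$ of $G_k$ satisfies $L_k \le N_k(N_f+1) + N_k^2/8$.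
   Context: A network is a finite simple undirected graph; links are edges. For an integer $N_f$, a network $G$ is $N_f$-robust if for every set $S$ of $N_f$ nodes of $G$, the network obtained by deleting the nodes of $S$ and their incident links is connected. The distance along a cycle between two of its nodes is the number of edges of the shorter of the two paths in the cycle between them. *)

theory Defs
  imports Complex_Main "Graph_Theory.Digraph_Component"
begin

text \<open>
  A network is a finite simple undirected graph, i.e. a \<^locale>\<open>pair_graph\<close>; each of its links is
  represented by the two opposite arcs between its end nodes.
\<close>

definition num_links :: "'a pair_pre_digraph \<Rightarrow> nat" where
  "num_links G = card {{u, v} | u v. (u, v) \<in> parcs G}"

definition robust :: "nat \<Rightarrow> 'a pair_pre_digraph \<Rightarrow> bool" where
  "robust n G \<longleftrightarrow>
     (\<forall>S. S \<subseteq> pverts G \<and> card S = n \<longrightarrow>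
        Digraph_Component.connected (with_proj G \<restriction> (pverts G - S)))"

text \<open>
  A cycle is given by the duplicate-free list of its nodes in cyclic order, the last node being
  adjacent to the first one. If two nodes occupy positions whose difference is \<open>d\<close>, then the two
  paths between them have \<open>d\<close> and \<open>length c - d\<close> edges.
\<close>

definition cycle_pos :: "'a list \<Rightarrow> 'a \<Rightarrow> nat" where
  "cycle_pos c x = (THE i. i < length c \<and> c ! i = x)"

definition cycle_dist :: "'a list \<Rightarrow> 'a \<Rightarrow> 'a \<Rightarrow> nat" where
  "cycle_dist c x y =
     (let d = nat \<bar>int (cycle_pos c x) - int (cycle_pos c y)\<bar> in min d (length c - d))"

definition arcs_within :: "'a list \<Rightarrow> nat \<Rightarrow> 'a rel" where
  "arcs_within c d = {(x, y). x \<in> set c \<and> y \<in> set c \<and> x \<noteq> y \<and> cycle_dist c x y \<le> d}"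

definition arcs_at :: "'a list \<Rightarrow> nat \<Rightarrow> 'a rel" where
  "arcs_at c d = {(x, y). x \<in> set c \<and> y \<in> set c \<and> x \<noteq> y \<and> cycle_dist c x y = d}"

text \<open>
  The initial network has no links besides the prescribed ones. For an odd number of nodes a node
  has two nodes at the maximal distance along the cycle, so the network is not determined by the
  cycle.
\<close>

definition initial_network :: "nat \<Rightarrow> 'a list \<Rightarrow> 'a pair_pre_digraph \<Rightarrow> bool" where
  "initial_network Nf c G \<longleftrightarrow>
     pverts G = set c \<and>
     (if even (length c)
      then parcs G = arcs_within c (Nf div 2) \<union> arcs_at c (length c div 2)
      else arcs_within c (Nf div 2) \<subseteq> parcs G \<and>
           parcs G \<subseteq> arcs_within c (Nf div 2) \<union> arcs_at c ((length c - 1) div 2) \<and>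
           (\<forall>x \<in> set c. \<exists>y. (x, y) \<in> parcs G \<inter> arcs_at c ((length c - 1) div 2)) \<and>
           (\<exists>!x. x \<in> set c \<and> out_degree (with_proj G) x = (Nf + 1) + 1))"

text \<open>
  The new node \<open>v\<close> is inserted between two adjacent nodes of the cycle \<open>xs @ ys\<close>; if \<open>xs\<close> or \<open>ys\<close>
  is empty, these are its last and its first node. The three sets of arcs added to those of \<open>G\<close>
  are the links of \<open>v\<close> to the nodes near it, the link of \<open>v\<close> to one farthest node \<open>w\<close>, and, for an
  even number of nodes, the links between all antipodal nodes (those already present are
  unaffected by the union).
\<close>

definition growth_step ::
    "nat \<Rightarrow> 'a list \<Rightarrow> 'a pair_pre_digraph \<Rightarrow> 'a list \<Rightarrow> 'a pair_pre_digraph \<Rightarrow> bool" where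
  "growth_step Nf c G c' G' \<longleftrightarrow>
     (\<exists>v w xs ys.
        v \<notin> pverts G \<and> c = xs @ ys \<and> c' = xs @ v # ys \<and>
        pverts G' = insert v (pverts G) \<and>
        (v, w) \<in> arcs_at c' (if even (length c') then length c' div 2 else (length c' - 1) div 2) \<and>
        parcs G' =
          parcs G
          \<union> symcl {(v, y) | y. (v, y) \<in> arcs_within c' (Nf div 2)}
          \<union> symcl {(v, w)}
          \<union> (if even (length c') then arcs_at c' (length c' div 2) else {}))"

end

theory Submission
  imports Defs
begin

text \<open>
  Inserting a node never shortens a distance along the cycle, so every network contains all links
  between nodes within distance \<open>Nf div 2\<close>, and every node keeps a link to a node at the largest
  possible distance. The former links survive the deletion of \<open>Nf\<close> nodes unless these form two
  separated blocks of \<open>Nf div 2\<close> consecutive nodes each; then a link of the latter kind joins the two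
  remaining arcs. For the number of links, a step adds at most \<open>Nf + 1\<close> links if \<open>N\<close> becomes odd and
  \<open>Nf + N / 2\<close> if \<open>N\<close> becomes even, which is matched by the increments of \<open>N * (Nf + 1) + M\<^sup>2 / 8\<close>,
  where \<open>M\<close> is the largest even number not above \<open>N\<close>.
\<close>

section \<open>Distances along a cycle\<close>

lemma cycle_pos_nth: "distinct c \<Longrightarrow> i < length c \<Longrightarrow> cycle_pos c (c ! i) = i"
  unfolding cycle_pos_def by (rule the_equality) (auto simp: nth_eq_iff_index_eq)

lemma cycle_pos_less:
  assumes "distinct c" "x \<in> set c"
  shows "cycle_pos c x < length c" "c ! cycle_pos c x = x"
  using assms by (auto simp: in_set_conv_nth cycle_pos_nth)

lemma cycle_dist_commute: "cycle_dist c x y = cycle_dist c y x"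
  unfolding cycle_dist_def by (simp add: abs_minus_commute)

lemma cycle_dist_le: "2 * cycle_dist c x y \<le> length c"
  unfolding cycle_dist_def Let_def by simp

lemma mod_add_cases:
  fixes a d n :: nat
  assumes "a < n" "d \<le> n"
  shows "(a + d) mod n = (if a + d < n then a + d else a + d - n)"
proof (cases "a + d < n")
  case False
  then have "(a + d) mod n = (a + d - n) mod n" by (simp add: le_mod_geq)
  also have "\<dots> = a + d - n" using assms by (intro mod_less) linarith
  finally show ?thesis using False by simp
qed simp

text \<open>Indices modulo \<open>length c\<close> let a walk pass the end of the list: without a
  wrap the positions differ by \<open>d\<close>, with one by \<open>length c - d\<close>, and
  \<open>min\<close> does not distinguish the two.\<close>

lemma cycle_dist_shift:
  assumes "distinct c" "c \<noteq> []" "d \<le> length c"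
  shows "cycle_dist c (c ! (i mod length c)) (c ! ((i + d) mod length c)) = min d (length c - d)"
proof -
  let ?n = "length c" and ?a = "i mod length c"
  have a: "?a < ?n" using assms by simp
  have b: "(i + d) mod ?n = (?a + d) mod ?n" by (simp add: mod_simps)
  have "(i + d) mod ?n < ?n" using assms by simp
  then show ?thesis
    using assms a unfolding cycle_dist_def Let_def
    by (auto simp: cycle_pos_nth b mod_add_cases)
qed

text \<open>The shorter path runs forward from one of the two nodes; which one is left open. An
  unordered pair is thus encoded by a start position and a distance, the form in which links are
  counted below.\<close>

lemma pair_at_cycle_dist:
  assumes "distinct c" "x \<in> set c" "y \<in> set c"
  obtains i where "i < length c" "{x, y} = {c ! i, c ! ((i + cycle_dist c x y) mod length c)}"
proof -
  have *: "\<exists>i < length c. {x, y} = {c ! i, c ! ((i + cycle_dist c x y) mod length c)}"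
    if "x \<in> set c" "y \<in> set c" "cycle_pos c x \<le> cycle_pos c y" for x y
  proof -
    let ?n = "length c" and ?d = "cycle_pos c y - cycle_pos c x"
    note x = cycle_pos_less[OF assms(1) that(1)] and y = cycle_pos_less[OF assms(1) that(2)]
    have d: "nat \<bar>int (cycle_pos c x) - int (cycle_pos c y)\<bar> = ?d" using that by simp
    show ?thesis
    proof (cases "?d \<le> ?n - ?d")
      case True
      then have "cycle_dist c x y = ?d" by (simp add: cycle_dist_def d)
      then show ?thesis using x y that by (intro exI[of _ "cycle_pos c x"]) simp
    next
      case False
      then have dist: "cycle_dist c x y = ?n - ?d" by (simp add: cycle_dist_def d)
      \<comment> \<open>Here the shorter path leaves \<open>y\<close> forward, passes the end of the
        list and arrives at \<open>x\<close>.\<close>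
      have "cycle_pos c y + (?n - ?d) = cycle_pos c x + ?n" using that x y by simp
      then have "(cycle_pos c y + (?n - ?d)) mod ?n = cycle_pos c x" using x by simp
      then show ?thesis unfolding dist using x y
        by (intro exI[of _ "cycle_pos c y"]) (simp add: insert_commute)
    qed
  qed
  show thesis
  proof (cases "cycle_pos c x \<le> cycle_pos c y")
    case True
    then show thesis using *[OF assms(2,3)] that by blast
  next
    case False
    then have "cycle_pos c y \<le> cycle_pos c x" by simp
    then show thesis
      using *[OF assms(3,2)] that by (metis cycle_dist_commute insert_commute)
  qed
qed

text \<open>Seen from a fixed node, the shorter path may run either way; \<open>d\<close> steps
  backward are written as \<open>length c - d\<close> steps forward, which avoids subtracting from
  positions.\<close>

lemma nth_mod_cycle_dist:
  fixes i :: nat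
  assumes "distinct c" "c \<noteq> []" "y \<in> set c"
  defines "d \<equiv> cycle_dist c (c ! (i mod length c)) y"
  shows "y = c ! ((i + d) mod length c) \<or> y = c ! ((i + (length c - d)) mod length c)"
proof -
  let ?n = "length c" and ?x = "c ! (i mod length c)"
  have "?x \<in> set c" using assms by simp
  then obtain j where j: "j < ?n" "{?x, y} = {c ! j, c ! ((j + d) mod ?n)}"
    using pair_at_cycle_dist assms by metis
  have lt: "i mod ?n < ?n" "(j + d) mod ?n < ?n" using assms by auto
  from j(2) consider "?x = c ! j" "y = c ! ((j + d) mod ?n)" | "?x = c ! ((j + d) mod ?n)" "y = c ! j"
    by (auto simp: doubleton_eq_iff)
  then show ?thesis
  proof cases
    case 1
    then have "j = i mod ?n" using assms(1) j(1) lt by (simp add: nth_eq_iff_index_eq)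
    then show ?thesis using 1 by (simp add: mod_simps)
  next
    case 2
    then have i: "i mod ?n = (j + d) mod ?n"
      using assms(1) lt by (simp add: nth_eq_iff_index_eq)
    have "d \<le> ?n" using cycle_dist_le[of c ?x y] d_def by simp
    have "(i + (?n - d)) mod ?n = (i mod ?n + (?n - d)) mod ?n" by (simp add: mod_simps)
    also have "\<dots> = (j + d + (?n - d)) mod ?n" unfolding i by (simp add: mod_simps)
    also have "\<dots> = j" using \<open>d \<le> ?n\<close> j(1) by simp
    finally show ?thesis using 2 by simp
  qed
qed

section \<open>Insertion of a node into the cycle\<close>

lemma cycle_pos_insert:
  assumes "distinct (xs @ v # ys)" "x \<in> set (xs @ ys)"
  shows "cycle_pos (xs @ v # ys) x =
    (if cycle_pos (xs @ ys) x < length xs then cycle_pos (xs @ ys) x else Suc (cycle_pos (xs @ ys) x))"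
    (is "_ = ?i")
proof -
  have "distinct (xs @ ys)" using assms by simp
  note p = cycle_pos_less[OF this assms(2)]
  then have i: "?i < length (xs @ v # ys)" "(xs @ v # ys) ! ?i = x"
    by (auto simp: nth_append Suc_diff_le split: if_splits)
  show ?thesis using cycle_pos_nth[OF assms(1) i(1)] unfolding i(2) .
qed

text \<open>Of the two paths between \<open>x\<close> and \<open>y\<close>, the one that receives
  \<open>v\<close> grows by one edge and the other keeps its length.\<close>

lemma cycle_dist_insert_mono:
  assumes "distinct (xs @ v # ys)" "x \<in> set (xs @ ys)" "y \<in> set (xs @ ys)"
  shows "cycle_dist (xs @ ys) x y \<le> cycle_dist (xs @ v # ys) x y"
proof -
  have "distinct (xs @ ys)" using assms by simp
  then have "cycle_pos (xs @ ys) x < length (xs @ ys)" "cycle_pos (xs @ ys) y < length (xs @ ys)"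
    using assms(2,3) by (simp_all only: cycle_pos_less)
  then show ?thesis
    unfolding cycle_dist_def Let_def cycle_pos_insert[OF assms(1,2)] cycle_pos_insert[OF assms(1,3)]
    by (auto simp: min_le_iff_disj diff_le_mono)
qed

lemma arcs_within_commute: "(x, y) \<in> arcs_within c d \<longleftrightarrow> (y, x) \<in> arcs_within c d"
  unfolding arcs_within_def by (auto simp: cycle_dist_commute)

lemma farthest_node_exists:
  assumes "distinct c" "length c \<ge> 2" "x \<in> set c"
  shows "\<exists>y. (x, y) \<in> arcs_at c (length c div 2)"
proof -
  let ?n = "length c" and ?h = "length c div 2" and ?i = "cycle_pos c x"
  let ?y = "c ! ((?i + ?h) mod ?n)"
  have ne: "c \<noteq> []" using assms by auto
  have i: "?i < ?n" "c ! ?i = x" using cycle_pos_less[OF assms(1,3)] by auto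
  have dist: "cycle_dist c x ?y = ?h"
    using cycle_dist_shift[OF assms(1) ne, of ?h ?i] i by auto
  have "cycle_dist c x x = 0" by (simp add: cycle_dist_def)
  then have "x \<noteq> ?y" using dist assms(2) by (metis div_greater_zero_iff less_irrefl pos2)
  moreover have "?y \<in> set c" using ne by simp
  ultimately show ?thesis using dist assms(3) unfolding arcs_at_def by blast
qed

section \<open>Robustness\<close>

text \<open>Take \<open>j\<close> as the first \<open>Q\<close> position from \<open>a\<close> on
  and \<open>i\<close> as the last \<open>P\<close> position before \<open>j\<close>.\<close>

lemma crossing_gap:
  fixes P Q :: "nat \<Rightarrow> bool"
  assumes "P a" "Q b" "a \<le> b" "\<And>k. \<not> (P k \<and> Q k)"
  obtains i j where "a \<le> i" "i < j" "j \<le> b" "P i" "Q j"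
    "\<And>k. i < k \<Longrightarrow> k < j \<Longrightarrow> \<not> P k" "\<And>k. a \<le> k \<Longrightarrow> k < j \<Longrightarrow> \<not> Q k"
proof -
  define j where "j = (LEAST j. a \<le> j \<and> Q j)"
  have j: "a \<le> j" "Q j" "j \<le> b" and jl: "\<And>k. a \<le> k \<Longrightarrow> k < j \<Longrightarrow> \<not> Q k"
    using LeastI[of "\<lambda>j. a \<le> j \<and> Q j" b] Least_le[of "\<lambda>j. a \<le> j \<and> Q j" b] not_less_Least
      assms(2,3) unfolding j_def by auto
  define A where "A = {k. a \<le> k \<and> k < j \<and> P k}"
  have fin: "finite A" unfolding A_def by simp
  have "a \<noteq> j" using j assms by blast
  then have "a \<in> A" using assms j by (simp add: A_def)
  then have "Max A \<in> A" using fin Max_in by blast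
  then have i: "a \<le> Max A" "Max A < j" "P (Max A)" by (auto simp: A_def)
  have "\<not> P k" if "Max A < k" "k < j" for k
    using that i Max_ge[OF fin, of k] unfolding A_def by fastforce
  with i j jl that show thesis by blast
qed

text \<open>
  A cut of the cycle must be crossed in both directions, and each crossing needs a gap of at least
  \<open>r\<close> deleted positions. As only \<open>2 * r\<close> positions are deleted, the two gaps are all of them, so
  \<open>P\<close> and \<open>Q\<close> are arcs; the end of the shorter arc sees its farthest positions inside the other.
\<close>

lemma cyclic_cut_impossible:
  fixes P Q :: "nat \<Rightarrow> bool" and n r :: nat
  defines "h \<equiv> n div 2"
  assumes r: "r \<ge> 1" and n: "n > 2 * r + 2"
    and per: "\<And>i. P (i + n) = P i" "\<And>i. Q (i + n) = Q i"
    and disj: "\<And>i. \<not> (P i \<and> Q i)"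
    and near: "\<And>i j. P i \<Longrightarrow> Q j \<Longrightarrow> i < j \<Longrightarrow> r < j - i" "\<And>i j. Q i \<Longrightarrow> P j \<Longrightarrow> i < j \<Longrightarrow> r < j - i"
    and few: "\<And>a. card {i. a < i \<and> i \<le> a + n \<and> \<not> P i \<and> \<not> Q i} \<le> 2 * r"
    and far: "\<And>i. P i \<Longrightarrow> Q (i + h) \<Longrightarrow> \<not> Q (i + (n - h))"
      "\<And>i. Q i \<Longrightarrow> P (i + h) \<Longrightarrow> \<not> P (i + (n - h))"
    and ex: "P p0" "Q q0" "p0 \<le> q0"
  shows False
proof -
  obtain p1 q1 where 1: "p0 \<le> p1" "p1 < q1" "P p1" "Q q1"
    and gap1: "\<And>k. p1 < k \<Longrightarrow> k < q1 \<Longrightarrow> \<not> P k" and noQ: "\<And>k. p0 \<le> k \<Longrightarrow> k < q1 \<Longrightarrow> \<not> Q k"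
    using crossing_gap[of P p0 Q q0] ex disj by metis
  \<comment> \<open>By periodicity \<open>P\<close> recurs at \<open>p1 + n\<close>, which cannot
    lie in the gap behind \<open>p1\<close>. So the crossing back from \<open>Q\<close> to
    \<open>P\<close> can be sought before the period ends.\<close>
  have "q1 \<le> p1 + n"
  proof (rule ccontr)
    assume "\<not> q1 \<le> p1 + n"
    then show False using gap1[of "p1 + n"] per(1)[of p1] 1 n by simp
  qed
  moreover have "P (p1 + n)" using 1 per by simp
  ultimately obtain q2 p2 where 2: "q1 \<le> q2" "q2 < p2" "p2 \<le> p1 + n" "Q q2" "P p2"
    and gap2: "\<And>k. q2 < k \<Longrightarrow> k < p2 \<Longrightarrow> \<not> Q k" and noP: "\<And>k. q1 \<le> k \<Longrightarrow> k < p2 \<Longrightarrow> \<not> P k"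
    using crossing_gap[of Q q1 P "p1 + n"] 1 disj by metis
  let ?bad = "{i. p1 < i \<and> i \<le> p1 + n \<and> \<not> P i \<and> \<not> Q i}"
  let ?gaps = "{p1<..<q1} \<union> {q2<..<p2}"
  have sub: "?gaps \<subseteq> ?bad" using 1 2 gap1 gap2 noP noQ by auto
  have fin: "finite ?bad" by simp
  have card: "card ?gaps = (q1 - p1 - 1) + (p2 - q2 - 1)"
    using 1 2 by (subst card_Un_disjoint) auto
  have len: "r < q1 - p1" "r < p2 - q2" using near 1 2 by blast+
  have "card ?gaps \<le> 2 * r" using card_mono[OF fin sub] few[of p1] by linarith
  then have gaps: "q1 = p1 + r + 1" "p2 = q2 + r + 1" using card len by linarith+
  have "card ?bad \<le> card ?gaps" using few[of p1] card gaps by simp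
  then have bad: "?bad = ?gaps" using card_seteq[OF fin sub] by simp
  have allQ: "Q k" if "q1 \<le> k" "k \<le> q2" for k
  proof -
    have "k \<notin> ?gaps" using that by auto
    then have "k \<notin> ?bad" by (simp only: bad not_False_eq_True)
    then show ?thesis using noP that 1 2 by auto
  qed
  have allP: "P k" if "p2 \<le> k" "k \<le> p1 + n" for k
    using that
  proof (induction k rule: dec_induct)
    case base
    then show ?case using 2 by simp
  next
    case (step k)
    have "Suc k \<notin> ?gaps" using step 1 2 by auto
    then have "Suc k \<notin> ?bad" by (simp only: bad not_False_eq_True)
    \<comment> \<open>A \<open>Q\<close> right behind a \<open>P\<close> would be at distance 1,
      which is at most \<open>r\<close>.\<close>
    moreover have "\<not> Q (Suc k)" using near(1)[of k "Suc k"] step r by auto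
    ultimately show ?case using step 1 2 by auto
  qed
  show False
  \<comment> \<open>The arcs from \<open>q1\<close> to \<open>q2\<close> and from \<open>p2\<close>
    to \<open>p1 + n\<close> have \<open>n - 2 * r - 2\<close> steps together. If the
    \<open>Q\<close> arc has at least half of them, it runs from \<open>p1 + r + 1\<close> to
    \<open>p1 + (n - h)\<close> or beyond and contains both positions opposite \<open>p1\<close>;
    otherwise the \<open>P\<close> arc contains both positions opposite \<open>q1\<close>.\<close>
  proof (cases "q2 - q1 \<ge> p1 + n - p2")
    case True
    have "Q (p1 + h)" "Q (p1 + (n - h))"
      using True gaps n 1 2 h_def by (intro allQ; linarith)+
    then show False using far(1) 1 by blast
  next
    case False
    have "P (q1 + h)" "P (q1 + (n - h))"
      using False gaps n 1 2 h_def by (intro allP; linarith)+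
    then show False using far(2) 1 by blast
  qed
qed

text \<open>If two surviving nodes were not connected, the component of one and the remaining
  survivors would give periodic predicates on positions as in \<open>cyclic_cut_impossible\<close>:
  \<open>within\<close> forces the wide gaps and \<open>far\<close> supplies the links
  across.\<close>

lemma robust_cycle_power_with_diameters:
  fixes c :: "'a list" and G :: "'a pair_pre_digraph"
  assumes "pair_graph G" "distinct c" "set c = pverts G" "r \<ge> 1" "length c > 2 * r + 2"
    and within: "arcs_within c r \<subseteq> parcs G"
    and far: "\<And>x. x \<in> set c \<Longrightarrow> \<exists>y. (x, y) \<in> parcs G \<inter> arcs_at c (length c div 2)"
  shows "robust (2 * r) G"
  unfolding robust_def
proof (intro allI impI)
  interpret pair_graph G by fact
  fix S assume S: "S \<subseteq> pverts G \<and> card S = 2 * r"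
  let ?T = "pverts G - S" and ?n = "length c" and ?h = "length c div 2"
  let ?H = "with_proj G \<restriction> ?T"
  let ?R = "rtrancl_on ?T (symcl (arcs_ends ?H))"
  have ends: "arcs_ends ?H = {(x, y) \<in> parcs G. x \<in> ?T \<and> y \<in> ?T}"
    by (auto simp: arcs_ends_conv induce_subgraph_arcs)
  have ne: "c \<noteq> []" using assms(5) by auto
  have finS: "finite S" using S pair_finite_verts finite_subset by blast
  \<comment> \<open>Connectedness includes that some node is left.\<close>
  have "card (pverts G) = ?n" using assms(2,3) distinct_card by metis
  then have "card ?T > 0" using S finS assms(5) by (simp add: card_Diff_subset)
  then have T: "?T \<noteq> {}" by (metis card.empty less_irrefl)
  have "(u, w) \<in> ?R" if u: "u \<in> ?T" and w: "w \<in> ?T" for u w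
  proof (rule ccontr)
    assume nr: "(u, w) \<notin> ?R"
    let ?x = "\<lambda>i. c ! (i mod ?n)"
    \<comment> \<open>\<open>A\<close> is the component of \<open>u\<close> and \<open>B\<close> the
      other survivors, so a position in neither carries a deleted node.\<close>
    define A where "A = {x \<in> ?T. (u, x) \<in> ?R}"
    define B where "B = ?T - A"
    have no_edge: False if "(x, y) \<in> parcs G" "x \<in> A \<and> y \<in> B \<or> x \<in> B \<and> y \<in> A" for x y
    proof -
      have *: "b \<in> A" if "a \<in> A" "b \<in> ?T" "(a, b) \<in> parcs G" for a b
      proof -
        have "(a, b) \<in> symcl (arcs_ends ?H)" using that by (auto simp: symcl_def ends A_def)
        then show ?thesis using that
          by (auto simp: A_def intro: rtrancl_on_into_rtrancl_on)
      qed
      show False using *[of x y] *[of y x] that arcs_symmetric[OF that(1)]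
        by (auto simp: B_def A_def)
    qed
    have in_c: "?x i \<in> set c" for i using ne by simp
    have close: "r < d" if "?x i \<in> A \<and> ?x (i + d) \<in> B \<or> ?x i \<in> B \<and> ?x (i + d) \<in> A" for i d
    proof (rule ccontr)
      assume "\<not> r < d"
      then have "d \<le> ?n" "min d (?n - d) \<le> r" using assms(5) by auto
      then have "cycle_dist c (?x i) (?x (i + d)) \<le> r"
        using cycle_dist_shift[OF assms(2) ne] by simp
      moreover have "?x i \<noteq> ?x (i + d)" using that by (auto simp: B_def)
      ultimately have "(?x i, ?x (i + d)) \<in> arcs_within c r" using in_c by (auto simp: arcs_within_def)
      then show False using no_edge within that by blast
    qed
    \<comment> \<open>It is unknown which of the two opposite positions the farthest link of
      \<open>?x i\<close> reaches, so both must lie on the other side. They coincide if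
      \<open>?n\<close> is even.\<close>
    have no_far: False
      if "?x i \<in> A \<and> ?x (i + ?h) \<in> B \<and> ?x (i + (?n - ?h)) \<in> B \<or>
          ?x i \<in> B \<and> ?x (i + ?h) \<in> A \<and> ?x (i + (?n - ?h)) \<in> A" for i
    proof -
      obtain y where y: "(?x i, y) \<in> parcs G" "y \<in> set c" "cycle_dist c (?x i) y = ?h"
        using far[OF in_c[of i]] by (auto simp: arcs_at_def)
      then have "y = ?x (i + ?h) \<or> y = ?x (i + (?n - ?h))"
        using nth_mod_cycle_dist[OF assms(2) ne y(2), of i] by simp
      then show False using no_edge[OF y(1)] that by auto
    qed
    have few: "card {i. a < i \<and> i \<le> a + ?n \<and> ?x i \<notin> A \<and> ?x i \<notin> B} \<le> 2 * r" (is "card ?I \<le> _") for a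
    proof -
      \<comment> \<open>A window of \<open>?n\<close> consecutive positions meets every node only
        once, so its bad positions inject into \<open>S\<close>.\<close>
      have "inj_on ?x {a<..a + ?n}"
      proof (rule inj_onI)
        fix i j assume ij: "i \<in> {a<..a + ?n}" "j \<in> {a<..a + ?n}" "?x i = ?x j"
        then have m: "i mod ?n = j mod ?n"
          using assms(2) ne by (simp add: nth_eq_iff_index_eq)
        have le: "i = j" if "i \<le> j" "i > a" "j \<le> a + ?n" "i mod ?n = j mod ?n" for i j
        proof -
          have "?n dvd j - i" using that by (metis mod_eq_dvd_iff_nat)
          moreover have "j - i < ?n" using that by linarith
          ultimately show ?thesis using that by (auto dest: dvd_imp_le)
        qed
        show "i = j"
        proof (cases "i \<le> j")
          case True
          then show ?thesis using le m ij by simp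
        next
          case False
          then have "j = i" using le[of j i] m ij by simp
          then show ?thesis by simp
        qed
      qed
      then have "inj_on ?x ?I" by (rule inj_on_subset) auto
      moreover have "?x ` ?I \<subseteq> S" using in_c assms(3) by (auto simp: B_def)
      ultimately have "card ?I \<le> card S" using card_inj_on_le finS by blast
      then show ?thesis using S by simp
    qed
    have uA: "u \<in> A" using u by (auto simp: A_def)
    have wB: "w \<in> B" using w nr by (auto simp: A_def B_def)
    note pu = cycle_pos_less[OF assms(2), of u] and pw = cycle_pos_less[OF assms(2), of w]
    have uw: "u \<in> set c" "w \<in> set c" using u w assms(3) by auto
    show False
    \<comment> \<open>The position of \<open>w\<close> is moved on by one full turn so that it does
      not precede that of \<open>u\<close>.\<close>
    proof (rule cyclic_cut_impossible[of r ?n "\<lambda>i. ?x i \<in> A" "\<lambda>i. ?x i \<in> B"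
          "cycle_pos c u" "cycle_pos c w + ?n"])
      show "?x i \<in> A \<Longrightarrow> ?x j \<in> B \<Longrightarrow> i < j \<Longrightarrow> r < j - i" for i j
        using close[of i "j - i"] by simp
      show "?x i \<in> B \<Longrightarrow> ?x j \<in> A \<Longrightarrow> i < j \<Longrightarrow> r < j - i" for i j
        using close[of i "j - i"] by simp
      show "?x (cycle_pos c u) \<in> A" "?x (cycle_pos c w + ?n) \<in> B" "cycle_pos c u \<le> cycle_pos c w + ?n"
        using pu pw uw uA wB by auto
    qed (use assms(4,5) few no_far in \<open>auto simp: B_def\<close>)
  qed
  then show "Digraph_Component.connected ?H"
    unfolding connected_conv using T by simp
qed

section \<open>Counting links\<close>

text \<open>The set counted by \<open>num_links\<close>, for an arbitrary relation, so that it can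
  be split along the unions of arcs in a growth step.\<close>

definition links :: "'a rel \<Rightarrow> 'a set set" where
  "links A = {{u, v} | u v. (u, v) \<in> A}"

lemma links_altdef: "links A = (\<lambda>(u, v). {u, v}) ` A"
  by (auto simp: links_def)

lemma links_Un: "links (A \<union> B) = links A \<union> links B"
  by (auto simp: links_altdef)

lemma links_symcl: "links (symcl A) = links A"
  by (auto simp: links_altdef symcl_def image_Un image_image insert_commute split_beta)

text \<open>A link is determined by the start of its shorter path and its length, which is
  \<open>h\<close> or one of \<open>1\<close>, ..., \<open>r\<close>.\<close>

lemma card_links_within_or_farthest_le:
  assumes "distinct c"
  shows "card (links (arcs_within c r \<union> arcs_at c h)) \<le> length c * (r + 1)"
proof -
  let ?f = "\<lambda>(i, d). {c ! i, c ! ((i + d) mod length c)}"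
  let ?D = "{..<length c} \<times> insert h {1..r}"
  have "links (arcs_within c r \<union> arcs_at c h) \<subseteq> ?f ` ?D"
  proof
    fix e assume "e \<in> links (arcs_within c r \<union> arcs_at c h)"
    then obtain x y where e: "e = {x, y}" and xy: "x \<in> set c" "y \<in> set c" "x \<noteq> y"
      and d: "cycle_dist c x y \<le> r \<or> cycle_dist c x y = h"
      by (auto simp: links_def arcs_within_def arcs_at_def)
    obtain i where i: "i < length c" "{x, y} = {c ! i, c ! ((i + cycle_dist c x y) mod length c)}"
      using pair_at_cycle_dist[OF assms xy(1,2)] .
    have "cycle_dist c x y \<noteq> 0"
    proof
      assume "cycle_dist c x y = 0"
      then have "{x, y} = {c ! i}" using i by simp
      then show False using xy(3) by (metis insertCI singletonD)
    qed
    then show "e \<in> ?f ` ?D" using e i d by (intro image_eqI[of _ _ "(i, cycle_dist c x y)"]) auto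
  qed
  then have "card (links (arcs_within c r \<union> arcs_at c h)) \<le> card ?D"
    by (intro surj_card_le) auto
  also have "card ?D = length c * card (insert h {1..r})" by (simp add: card_cartesian_product)
  also have "\<dots> \<le> length c * (r + 1)"
    using card_insert_le_m1[of "r + 1" "{1..r}" h] by (intro mult_le_mono) auto
  finally show ?thesis .
qed

text \<open>Starting at \<open>i\<close> or half a turn later gives the same antipodal pair, so
  start positions in the first half suffice.\<close>

lemma card_links_antipodal_le:
  assumes "distinct c" "even (length c)"
  shows "card (links (arcs_at c (length c div 2))) \<le> length c div 2"
proof -
  let ?n = "length c" and ?h = "length c div 2"
  have sub: "links (arcs_at c ?h) \<subseteq> (\<lambda>i. {c ! i, c ! (i + ?h)}) ` {..<?h}"
  proof
    fix e assume "e \<in> links (arcs_at c ?h)"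
    then obtain x y where e: "e = {x, y}" and xy: "x \<in> set c" "y \<in> set c"
      and d: "cycle_dist c x y = ?h"
      by (auto simp: links_def arcs_at_def)
    obtain i where i: "i < ?n" "{x, y} = {c ! i, c ! ((i + ?h) mod ?n)}"
      using pair_at_cycle_dist[OF assms(1) xy] d by metis
    have n: "?n = 2 * ?h" using assms(2) by simp
    show "e \<in> (\<lambda>i. {c ! i, c ! (i + ?h)}) ` {..<?h}"
    proof (cases "i < ?h")
      case True
      then have "(i + ?h) mod ?n = i + ?h" using n by (intro mod_less) linarith
      then show ?thesis using e i True by auto
    next
      case False
      then have "(i + ?h) mod ?n = i - ?h"
        using mod_add_cases[OF i(1), of ?h] n by (simp split: if_splits)
      then have "e = {c ! (i - ?h), c ! (i - ?h + ?h)}" using e i False by auto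
      moreover have "i - ?h < ?h" using i n by linarith
      ultimately show ?thesis by blast
    qed
  qed
  show "card (links (arcs_at c ?h)) \<le> ?h" using surj_card_le[OF _ sub] by simp
qed

lemma card_links_node_within_le:
  assumes "distinct c" "v \<in> set c" "r \<le> length c"
  shows "card (links {(v, y) | y. (v, y) \<in> arcs_within c r}) \<le> 2 * r"
proof -
  let ?n = "length c" and ?i = "cycle_pos c v"
  let ?L = "links {(v, y) | y. (v, y) \<in> arcs_within c r}"
  \<comment> \<open>Offsets in \<open>{1..r}\<close> reach the near nodes ahead of \<open>v\<close>,
    those in \<open>{?n - r..<?n}\<close> the near nodes behind it.\<close>
  let ?f = "\<lambda>d. {v, c ! ((?i + d) mod ?n)}" and ?D = "{1..r} \<union> {?n - r..<?n}"
  have ne: "c \<noteq> []" using assms by auto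
  have v: "c ! (?i mod ?n) = v" using cycle_pos_less[OF assms(1,2)] by simp
  have sub: "?L \<subseteq> ?f ` ?D"
  proof
    fix e assume "e \<in> ?L"
    then obtain y where e: "e = {v, y}" and y: "y \<in> set c" "v \<noteq> y" "cycle_dist c v y \<le> r"
      by (auto simp: links_def arcs_within_def)
    obtain d where d: "d = cycle_dist c v y" by blast
    have dy: "y = c ! ((?i + d) mod ?n) \<or> y = c ! ((?i + (?n - d)) mod ?n)"
      using nth_mod_cycle_dist[OF assms(1) ne y(1), of ?i] unfolding v d .
    have "d \<noteq> 0" using dy y(2) v by (intro notI) simp
    then have "d \<in> ?D" "?n - d \<in> ?D" using y(3) d ne by auto
    moreover have "e = ?f d \<or> e = ?f (?n - d)" using dy e by blast
    ultimately show "e \<in> ?f ` ?D" by (elim disjE) (rule image_eqI, assumption+)+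
  qed
  have "card ?D \<le> card {1..r} + card {?n - r..<?n}" by (rule card_Un_le)
  also have "\<dots> = 2 * r" using assms(3) by simp
  finally show "card ?L \<le> 2 * r" using surj_card_le[OF _ sub] by simp
qed

section \<open>Links of the initial network and links added by a step\<close>

lemma num_links_initial_le:
  assumes "initial_network Nf c G" "distinct c"
  shows "num_links G \<le> length c * (Nf + 1)"
proof -
  have "parcs G \<subseteq> arcs_within c (Nf div 2) \<union> arcs_at c (length c div 2)"
    using assms(1) by (auto simp: initial_network_def elim!: oddE split: if_splits)
  then have "links (parcs G) \<subseteq> links (arcs_within c (Nf div 2) \<union> arcs_at c (length c div 2))"
    by (auto simp: links_altdef)
  moreover have "finite (arcs_within c (Nf div 2) \<union> arcs_at c (length c div 2))"
    by (rule finite_subset[of _ "set c \<times> set c"]) (auto simp: arcs_within_def arcs_at_def)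
  then have "finite (links (arcs_within c (Nf div 2) \<union> arcs_at c (length c div 2)))"
    unfolding links_altdef by (rule finite_imageI)
  ultimately have "card (links (parcs G)) \<le>
      card (links (arcs_within c (Nf div 2) \<union> arcs_at c (length c div 2)))"
    by (intro card_mono)
  also have "\<dots> \<le> length c * (Nf div 2 + 1)"
    by (rule card_links_within_or_farthest_le[OF assms(2)])
  also have "\<dots> \<le> length c * (Nf + 1)" by (intro mult_le_mono) auto
  finally show ?thesis by (simp add: num_links_def links_def)
qed

lemma num_links_growth_step_le:
  assumes "growth_step Nf c G c' G'" "distinct c'" "Nf \<le> length c'" "even Nf"
  shows "num_links G' \<le>
    num_links G + Nf + (if even (length c') then length c' div 2 else 1)"
proof -
  let ?h = "if even (length c') then length c' div 2 else (length c' - 1) div 2"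
  obtain v w xs ys where c': "c' = xs @ v # ys" and w: "(v, w) \<in> arcs_at c' ?h"
    and arcs: "parcs G' = parcs G \<union> symcl {(v, y) | y. (v, y) \<in> arcs_within c' (Nf div 2)}
          \<union> symcl {(v, w)} \<union> (if even (length c') then arcs_at c' (length c' div 2) else {})"
    using assms(1) unfolding growth_step_def by blast
  let ?V = "links {(v, y) | y. (v, y) \<in> arcs_within c' (Nf div 2)}"
  \<comment> \<open>For an even length the link from \<open>v\<close> to \<open>w\<close> is itself
    antipodal, so it is already among the at most \<open>length c' div 2\<close> antipodal links and
    costs nothing extra.\<close>
  let ?X = "if even (length c') then links (arcs_at c' (length c' div 2)) else {{v, w}}"
  have "links (parcs G') = links (parcs G) \<union> ?V \<union> ?X"
    using w unfolding arcs links_Un links_symcl by (auto simp: links_altdef)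
  then have "num_links G' = card (links (parcs G) \<union> ?V \<union> ?X)"
    by (simp only: num_links_def links_def[of "parcs G'", symmetric])
  also have "\<dots> \<le> card (links (parcs G) \<union> ?V) + card ?X" by (rule card_Un_le)
  also have "\<dots> \<le> card (links (parcs G)) + card ?V + card ?X"
    by (intro add_right_mono card_Un_le)
  finally have "num_links G' \<le> card (links (parcs G)) + card ?V + card ?X" .
  moreover have "card ?V \<le> Nf"
    using card_links_node_within_le[OF assms(2), of v "Nf div 2"] assms(3,4) c' by auto
  moreover have "card ?X \<le> (if even (length c') then length c' div 2 else 1)"
    using card_links_antipodal_le[OF assms(2)] by auto
  ultimately show ?thesis by (simp add: num_links_def links_def)
qed

section \<open>Invariants of the growth process\<close>

text \<open>Pairs containing the new node are linked by the step. Old pairs that are near in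
  \<open>c'\<close> were at least as near in \<open>c\<close>, hence already linked.\<close>

lemma growth_step_within:
  assumes "growth_step Nf c G c' G'" "distinct c'" "arcs_within c (Nf div 2) \<subseteq> parcs G"
  shows "arcs_within c' (Nf div 2) \<subseteq> parcs G'"
proof -
  obtain v xs ys where c: "c = xs @ ys" "c' = xs @ v # ys"
    and arcs: "parcs G \<union> symcl {(v, y) | y. (v, y) \<in> arcs_within c' (Nf div 2)} \<subseteq> parcs G'"
    using assms(1) unfolding growth_step_def by blast
  show ?thesis
  proof (rule subrelI)
    fix x y assume xy: "(x, y) \<in> arcs_within c' (Nf div 2)"
    consider "x = v" | "y = v" | "x \<noteq> v" "y \<noteq> v" by blast
    then show "(x, y) \<in> parcs G'"
    proof cases
      case 1
      then show ?thesis using xy arcs by (auto simp: symcl_def)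
    next
      case 2
      then have "(v, x) \<in> arcs_within c' (Nf div 2)" using xy arcs_within_commute by metis
      then show ?thesis using 2 arcs by (force simp: symcl_def)
    next
      case 3
      then have "x \<in> set c" "y \<in> set c" "x \<noteq> y" using xy c by (auto simp: arcs_within_def)
      moreover have "cycle_dist c x y \<le> Nf div 2"
        using cycle_dist_insert_mono[of xs v ys x y] assms(2) c xy calculation
        by (auto simp: arcs_within_def)
      ultimately show ?thesis using assms(3) arcs by (auto simp: arcs_within_def)
    qed
  qed
qed

text \<open>
  When the number of nodes becomes odd, the formerly antipodal pairs keep their distance, which is
  still the largest possible one.
\<close>

lemma growth_step_farthest:
  assumes "growth_step Nf c G c' G'" "distinct c'" "length c \<ge> 2"
    and "even (length c) \<Longrightarrow> arcs_at c (length c div 2) \<subseteq> parcs G"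
    and "x \<in> set c'"
  shows "\<exists>y. (x, y) \<in> parcs G' \<inter> arcs_at c' (length c' div 2)"
proof -
  let ?h = "if even (length c') then length c' div 2 else (length c' - 1) div 2"
  obtain v w xs ys where c: "c = xs @ ys" "c' = xs @ v # ys" and w: "(v, w) \<in> arcs_at c' ?h"
    and arcs: "parcs G' = parcs G \<union> symcl {(v, y) | y. (v, y) \<in> arcs_within c' (Nf div 2)}
          \<union> symcl {(v, w)} \<union> (if even (length c') then arcs_at c' (length c' div 2) else {})"
    using assms(1) unfolding growth_step_def by blast
  show ?thesis
  proof (cases "even (length c')")
    case True
    then have "arcs_at c' (length c' div 2) \<subseteq> parcs G'" using arcs by simp
    moreover have "length c' \<ge> 2" using assms(3) c by simp
    ultimately show ?thesis using farthest_node_exists[OF assms(2) _ assms(5)] by (metis IntI subsetD)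
  next
    case False
    then have "(length c' - 1) div 2 = length c' div 2" by (auto elim!: oddE)
    then have vw: "(v, w) \<in> parcs G' \<inter> arcs_at c' (length c' div 2)"
      using w False arcs by (simp add: symcl_def)
    have len: "even (length c)" "length c' div 2 = length c div 2" using False c by auto
    show ?thesis
    proof (cases "x = v")
      case True
      then show ?thesis using vw by blast
    next
      case False
      then have x: "x \<in> set c" using assms(5) c by auto
      moreover have "distinct c" using assms(2) c by simp
      ultimately obtain y where y: "(x, y) \<in> arcs_at c (length c div 2)"
        using farthest_node_exists[OF _ assms(3)] by metis
      then have "cycle_dist c' x y \<ge> length c' div 2" "y \<in> set c"
        using cycle_dist_insert_mono[of xs v ys x y] assms(2) c len by (auto simp: arcs_at_def)
      moreover have "cycle_dist c' x y \<le> length c' div 2" using cycle_dist_le[of c' x y] by linarith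
      ultimately have "(x, y) \<in> arcs_at c' (length c' div 2)"
        using y c by (auto simp: arcs_at_def)
      moreover have "(x, y) \<in> parcs G'" using y assms(4)[OF len(1)] arcs by auto
      ultimately show ?thesis by blast
    qed
  qed
qed

theorem theorem6:
  fixes Nf :: nat
    and G :: "nat \<Rightarrow> 'a pair_pre_digraph"
    and C :: "nat \<Rightarrow> 'a list"
    and N :: "nat \<Rightarrow> nat"
  assumes "even Nf" and "Nf > 0"
    and "\<And>k. k \<ge> 1 \<Longrightarrow> pair_graph (G k)"
    and "\<And>k. k \<ge> 1 \<Longrightarrow> N k = card (pverts (G k))"
    and "\<And>k. k \<ge> 2 \<Longrightarrow> N k = N (k - 1) + 1"
    and "\<And>k. k \<ge> 1 \<Longrightarrow> int Nf < int (N k) - 2"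
    and "\<And>k. k \<ge> 1 \<Longrightarrow> distinct (C k) \<and> set (C k) = pverts (G k)"
    and "initial_network Nf (C 1) (G 1)"
    and "\<And>k. k \<ge> 2 \<Longrightarrow> growth_step Nf (C (k - 1)) (G (k - 1)) (C k) (G k)"
  shows "(\<forall>i j. 1 \<le> i \<and> i \<le> j \<longrightarrow> subgraph (with_proj (G i)) (with_proj (G j))) \<and>
         (\<forall>k\<ge>1. robust Nf (G k)) \<and>
         (\<forall>k\<ge>1. real (num_links (G k)) \<le> real (N k) * (real Nf + 1) + (real (N k))\<^sup>2 / 8)"
proof (intro conjI allI impI)
  have growth: "growth_step Nf (C k) (G k) (C (Suc k)) (G (Suc k))" if "k \<ge> 1" for k
    using assms(9)[of "Suc k"] that by simp
  have len: "length (C k) = N k" if "k \<ge> 1" for k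
    using assms(4,7) that distinct_card by metis
  have big: "N k > Nf + 2" if "k \<ge> 1" for k using assms(6)[OF that] by linarith
  have dist: "distinct (C k)" "set (C k) = pverts (G k)" if "k \<ge> 1" for k
    using assms(7) that by auto

  show "subgraph (with_proj (G i)) (with_proj (G j))" if "1 \<le> i \<and> i \<le> j" for i j
  proof -
    have "pverts (G i) \<subseteq> pverts (G j) \<and> parcs (G i) \<subseteq> parcs (G j)"
      using conjunct2[OF that]
    proof (induction j rule: dec_induct)
      case (step k)
      have "growth_step Nf (C k) (G k) (C (Suc k)) (G (Suc k))"
        using that step.hyps by (intro growth) simp
      then show ?case using step.IH unfolding growth_step_def by blast
    qed simp
    moreover have "wf_digraph (with_proj (G k))" if "k \<ge> 1" for k
    proof -
      interpret pair_graph "G k" using assms(3) that .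
      show ?thesis by unfold_locales
    qed
    ultimately show ?thesis using that by (intro subgraphI) auto
  qed

  \<comment> \<open>This needs no induction: the initial network and every step to an even length
    link all antipodal pairs outright.\<close>
  have antipodal: "arcs_at (C k) (length (C k) div 2) \<subseteq> parcs (G k)" if "k \<ge> 1" "even (length (C k))" for k
  proof (cases "k = 1")
    case True
    then show ?thesis using assms(8) that by (auto simp: initial_network_def)
  next
    case False
    then show ?thesis using assms(9)[of k] that unfolding growth_step_def by auto
  qed

  show "robust Nf (G k)" if "k \<ge> 1" for k
  proof -
    have "arcs_within (C k) (Nf div 2) \<subseteq> parcs (G k)"
      using that
    proof (induction k rule: dec_induct)
      case base
      then show ?case using assms(8) by (auto simp: initial_network_def split: if_splits)
    next
      case (step k)
      show ?case
        by (rule growth_step_within[OF growth[OF step.hyps(1)] dist(1) step.IH]) simp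
    qed
    moreover have "\<exists>y. (x, y) \<in> parcs (G k) \<inter> arcs_at (C k) (length (C k) div 2)" if "x \<in> set (C k)" for x
    proof (cases "k = 1")
      case True
      show ?thesis
      proof (cases "even (length (C 1))")
        case even: True
        have "length (C 1) \<ge> 2" using len[of 1] big[of 1] by simp
        then show ?thesis
          using farthest_node_exists[of "C 1" x] dist[of 1] antipodal[of 1] even that True by blast
      next
        case False
        then have "(length (C 1) - 1) div 2 = length (C 1) div 2" by (auto elim!: oddE)
        then show ?thesis using assms(8) False True that by (auto simp: initial_network_def)
      qed
    next
      case False
      \<comment> \<open>The farthest links of \<open>G k\<close> come from the last step and from
        the antipodal links of \<open>G (k - 1)\<close> alone.\<close>
      then have k: "k \<ge> 2" "k - 1 \<ge> 1" using \<open>k \<ge> 1\<close> by auto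
      show ?thesis
        using growth_step_farthest[OF assms(9)[OF k(1)]] dist(1)[OF \<open>k \<ge> 1\<close>] that
          antipodal[OF k(2)] len[OF k(2)] big[OF k(2)] by auto
    qed
    ultimately have "robust (2 * (Nf div 2)) (G k)"
      using assms(1,2,3) dist len big that
      by (intro robust_cycle_power_with_diameters[of "G k" "C k"]) auto
    then show ?thesis using assms(1) by simp
  qed

  show "real (num_links (G k)) \<le> real (N k) * (real Nf + 1) + (real (N k))\<^sup>2 / 8" if "k \<ge> 1" for k
  proof -
    \<comment> \<open>With the square of \<open>N k\<close> itself the induction would break: a step
      to an even \<open>N\<close> may add \<open>Nf + N / 2\<close> links, while
      \<open>N\<^sup>2 / 8\<close> grows only by about \<open>N / 4\<close>. Rounding down to an
      even number concentrates the growth in these steps, where the square term gains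
      \<open>(N - 1) / 2\<close> and the linear term \<open>Nf + 1\<close>.\<close>
    have "real (num_links (G k)) \<le>
        real (N k) * (real Nf + 1) + (if even (N k) then real (N k) else real (N k) - 1)\<^sup>2 / 8"
      using that
    proof (induction k rule: dec_induct)
      case base
      have "num_links (G 1) \<le> N 1 * (Nf + 1)"
        using num_links_initial_le[OF assms(8)] dist(1)[of 1] len[of 1] by simp
      then have "real (num_links (G 1)) \<le> real (N 1 * (Nf + 1))" by (simp only: of_nat_le_iff)
      also have "\<dots> = real (N 1) * (real Nf + 1)" by (simp add: distrib_left)
      finally show ?case by (rule order_trans) simp
    next
      case (step k)
      have N: "N (Suc k) = N k + 1" using assms(5)[of "Suc k"] step.hyps by simp
      have "num_links (G (Suc k)) \<le>
          num_links (G k) + Nf + (if even (N (Suc k)) then N (Suc k) div 2 else 1)"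
        using num_links_growth_step_le[OF growth[OF step.hyps(1)]]
          dist(1)[of "Suc k"] len[of "Suc k"] big[of "Suc k"] assms(1) step.hyps
        by auto
      then have grow: "real (num_links (G (Suc k))) \<le>
          real (num_links (G k)) + real Nf + (if even (N (Suc k)) then real (N (Suc k)) / 2 else 1)"
        by (auto simp flip: of_nat_add of_nat_Suc simp: real_of_nat_div split: if_splits)
      show ?case
      proof (cases "even (N k)")
        case True
        then show ?thesis using grow step.IH N by (simp add: algebra_simps)
      next
        case False
        then show ?thesis using grow step.IH N by (simp add: power2_eq_square field_simps)
      qed
    qed
    \<comment> \<open>The rounding is undone; squaring is monotone here because
      \<open>N k - 1\<close> is nonnegative.\<close>
    also have "\<dots> \<le> real (N k) * (real Nf + 1) + (real (N k))\<^sup>2 / 8"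
      using big[OF that] by (auto intro!: power_mono)
    finally show ?thesis .
  qed
qed

end
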